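(* Let $\mathcal{T}$ be a set of Wang tiles such that all states in the transducer graphs $G_{\mathrm{t,h}}$ and $G_{\mathrm{t,v}}$ are in at least one (directed) graph cycle. Then, for every rectangular domain $\tilde{\mathcal{A}}=\{1,\dots,n_{\mathrm h}\}\times\{1,\dots,n_{\mathrm w}\}$, the $2/3$-approximation algorithm described in the context terminates with a cover containing at least $\tfrac23|\tilde{\mathcal{A}}|$ placed tiles.
   Context: Tiles and covers. A Wang tile $k$ is a quadruple $(c_k^{\mathrm n},c_k^{\mathrm w},c_k^{\mathrm s},c_k^{\mathrm e})$ of colors from a finite set $\mathcal{C}=\{1,\dots,n_{\mathrm c}\}$ (north, west, south, east edge). $(i,j)$ denotes row $i$ (counted downwards) and column $j$ (counted to the right); $\mathcal{H}=\{1,\dots,n_{\mathrm h}\}$, $\mathcal{W}=\{1,\dots,n_{\mathrm w}\}$, $\tilde{\mathcal{A}}=\mathcal{H}\times\mathcal{W}$. A cover of $\tilde{\mathcal{A}}$ assigns to each coordinate a tile of $\mathcal{T}$ or a void so that any two adjacent coordinates both carrying tiles have equal colors on their shared edge; there is no condition involving voids. Transducer graphs. $G_{\mathrm{t,h}}$ is the directed multigraph with vertex (state) set $\mathcal{C}$ and one arc $c_k^{\mathrm w}\to c_k^{\mathrm e}$ for each $k\in\mathcal{T}$. The dual transducer graph $G_{\mathrm{t,v}}$ has vertex set $\mathcal{C}$ and one arc $c_k^{\mathrm n}\to c_k^{\mathrm s}$ for each $k\in\mathcal{T}$. Row step. Given the current contents of the other rows, covering row $i$ means: replace the contents of row $i$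 by an assignment of tiles/voids to $\{i\}\times\mathcal{W}$ which has matching east/west colors between adjacent tiles, uses at $(i,j)$ only tiles whose north (south) color matches the tile currently at $(i-1,j)$ (at $(i+1,j)$) if there is one, and minimizes (number of voids) + (sum of penalties of placed tiles), ties broken arbitrarily. (This is computed as a shortest path in a directed acyclic graph.) Penalties are small, with total penalty of a row always less than $1$, so that a row step always places the maximum possible number of tiles. In a standard row step a tile at $(i,j)$ is penalized by $\frac{1}{2(|\mathcal{W}|+1)}$ for each void vertical neighbor position which cannot be filled by any tile matching the given tile's color on the shared edge. In a dual-transducer row step with parameter $m$, compatibility with the void row above is not examined; instead a tile at $(i,j)$ is penalized by $\frac{1}{2(|\mathcal{W}|+1)}$ if there is a tile at $(i-1-m,j)$ and the north color of the tile at $(i,j)$ is not reachable in $G_{\mathrm{t,v}}$ from the south color of the tile at $(i-1-m,j)$ by a directed walk with exactly $m$ arcs (a void at $(i-1-m,j)$, or no such row, is compatible with everything). Algorithm. Start with all voids. Process rows in the order $1,4,3,2,3,7,6,5,6,10,9,8,9,\dots$ (row numbers exceeding $n_{\mathrm h}$ are skipped). Rows $i\equiv 1 \pmod 3$: a dual-transducer row step with $m=2$. Rows $i\equiv 0\pmod 3$: at the first visit, a dual-transducer row step with $m=1$ in which additionally all even positions $j$ are forced to be void; at the second visit, a standard row step. Rows $i\equiv 2\pmod 3$: a standard row step. Output the resulting cover. *)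

theory Defs
  imports Complex_Main "Graph_Theory.Graph_Theory"
begin

section \<open>Wang tiles, transducer graphs and covers\<close>

type_synonym color = nat

datatype tile = Tile (north: color) (west: color) (south: color) (east: color)

definition tiles_over :: "nat \<Rightarrow> tile set" where
  "tiles_over nc =
     {t. north t \<in> {1..nc} \<and> west t \<in> {1..nc} \<and> south t \<in> {1..nc} \<and> east t \<in> {1..nc}}"

definition transducer_h :: "nat \<Rightarrow> tile set \<Rightarrow> (color, tile) pre_digraph" where
  "transducer_h nc T = \<lparr>verts = {1..nc}, arcs = T, tail = west, head = east\<rparr>"

definition transducer_v :: "nat \<Rightarrow> tile set \<Rightarrow> (color, tile) pre_digraph" where
  "transducer_v nc T = \<lparr>verts = {1..nc}, arcs = T, tail = north, head = south\<rparr>"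

text \<open>A cycle is given by its list of arcs, so its vertices are the tails of these arcs.\<close>

definition all_on_cycles :: "('a, 'b) pre_digraph \<Rightarrow> bool" where
  "all_on_cycles G \<longleftrightarrow>
     (\<forall>v \<in> verts G. \<exists>p. pre_digraph.cycle G p \<and> v \<in> tail G ` set p)"

definition domain :: "nat \<Rightarrow> nat \<Rightarrow> (nat \<times> nat) set" where
  "domain nh nw = {1..nh} \<times> {1..nw}"

text \<open>
  The coordinate (i, j) is row i (counted downwards) and column j. The value \<^term>\<open>None\<close> is a void;
  coordinates outside the domain are always mapped to \<^term>\<open>None\<close>.
\<close>

type_synonym assignment = "nat \<times> nat \<Rightarrow> tile option"

definition is_cover :: "nat \<Rightarrow> nat \<Rightarrow> tile set \<Rightarrow> assignment \<Rightarrow> bool" where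
  "is_cover nh nw T f \<longleftrightarrow>
     dom f \<subseteq> domain nh nw \<and> ran f \<subseteq> T \<and>
     (\<forall>i j s t. f (i, j) = Some s \<longrightarrow> f (i, j + 1) = Some t \<longrightarrow> east s = west t) \<and>
     (\<forall>i j s t. f (i, j) = Some s \<longrightarrow> f (i + 1, j) = Some t \<longrightarrow> south s = north t)"


section \<open>Row steps\<close>

definition set_row :: "nat \<Rightarrow> (nat \<Rightarrow> tile option) \<Rightarrow> assignment \<Rightarrow> assignment" where
  "set_row i r f = (\<lambda>(a, b). if a = i then r b else f (a, b))"

text \<open>
  Rows are numbered from 1. In the definitions below, row 0 (reached as \<^term>\<open>i - 1\<close> for \<^term>\<open>i = 1\<close>,
  or as the truncated difference \<^term>\<open>i - 1 - m\<close>) lies outside the domain and carries no tiles.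
  The set J consists of the columns in which a tile may be placed.
\<close>

definition feasible_row ::
  "nat \<Rightarrow> tile set \<Rightarrow> assignment \<Rightarrow> nat \<Rightarrow> nat set \<Rightarrow> (nat \<Rightarrow> tile option) \<Rightarrow> bool" where
  "feasible_row nw T f i J r \<longleftrightarrow>
     dom r \<subseteq> {1..nw} \<inter> J \<and> ran r \<subseteq> T \<and>
     (\<forall>j s t. r j = Some s \<longrightarrow> r (j + 1) = Some t \<longrightarrow> east s = west t) \<and>
     (\<forall>j s t. f (i - 1, j) = Some s \<longrightarrow> r j = Some t \<longrightarrow> south s = north t) \<and>
     (\<forall>j s t. r j = Some s \<longrightarrow> f (i + 1, j) = Some t \<longrightarrow> south s = north t)"

text \<open>
  The position p is a void of the domain that, once t is placed at (i, j), no tile can fill: a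
  filling tile has to match t and the tiles currently present next to p. The old contents of
  row i are discarded, as they are about to be replaced.
\<close>

definition blocked ::
  "nat \<Rightarrow> nat \<Rightarrow> tile set \<Rightarrow> assignment \<Rightarrow> nat \<Rightarrow> nat \<Rightarrow> tile \<Rightarrow> nat \<times> nat \<Rightarrow> bool" where
  "blocked nh nw T f i j t p \<longleftrightarrow>
     p \<in> domain nh nw \<and> f p = None \<and>
     \<not> (\<exists>u \<in> T. is_cover nh nw T ((set_row i (\<lambda>_. None) f)((i, j) \<mapsto> t, p \<mapsto> u)))"

definition walk_reachable :: "('a, 'b) pre_digraph \<Rightarrow> nat \<Rightarrow> 'a \<Rightarrow> 'a \<Rightarrow> bool" where
  "walk_reachable G m u v \<longleftrightarrow> (\<exists>p. pre_digraph.awalk G u p v \<and> length p = m)"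

datatype step_kind = Standard | Dual nat

fun penalty ::
  "nat \<Rightarrow> nat \<Rightarrow> nat \<Rightarrow> tile set \<Rightarrow> step_kind \<Rightarrow> assignment \<Rightarrow> nat \<Rightarrow> nat \<Rightarrow> tile \<Rightarrow> real" where
  "penalty nc nh nw T Standard f i j t =
     1 / (2 * (real nw + 1)) *
       (of_bool (blocked nh nw T f i j t (i - 1, j)) +
        of_bool (blocked nh nw T f i j t (i + 1, j)))"
| "penalty nc nh nw T (Dual m) f i j t =
     1 / (2 * (real nw + 1)) *
       (of_bool (\<exists>s. f (i - 1 - m, j) = Some s \<and>
                     \<not> walk_reachable (transducer_v nc T) m (south s) (north t)) +
        of_bool (blocked nh nw T f i j t (i + 1, j)))"

definition row_cost ::
  "nat \<Rightarrow> nat \<Rightarrow> nat \<Rightarrow> tile set \<Rightarrow> step_kind \<Rightarrow> assignment \<Rightarrow> nat \<Rightarrow> (nat \<Rightarrow> tile option) \<Rightarrow> real"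
  where
  "row_cost nc nh nw T k f i r =
     real (card {j \<in> {1..nw}. r j = None}) +
     (\<Sum>j \<in> {j \<in> {1..nw}. r j \<noteq> None}. penalty nc nh nw T k f i j (the (r j)))"

text \<open>As ties are broken arbitrarily, a row step is a relation between assignments.\<close>

definition row_step ::
  "nat \<Rightarrow> nat \<Rightarrow> nat \<Rightarrow> tile set \<Rightarrow> step_kind \<Rightarrow> nat set \<Rightarrow> nat \<Rightarrow> assignment \<Rightarrow> assignment \<Rightarrow> bool"
  where
  "row_step nc nh nw T k J i f f' \<longleftrightarrow>
     (\<exists>r. is_arg_min (row_cost nc nh nw T k f i) (feasible_row nw T f i J) r \<and>
          f' = set_row i r f)"


section \<open>The algorithm\<close>

datatype visit = First nat | Second nat

fun visited_row :: "visit \<Rightarrow> nat" where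
  "visited_row (First i) = i"
| "visited_row (Second i) = i"

text \<open>
  The order 1, 4, 3, 2, 3, 7, 6, 5, 6, ... with the rows exceeding \<^term>\<open>nh\<close> removed. All rows of
  the blocks with index \<^term>\<open>b \<ge> nh\<close> exceed \<^term>\<open>nh\<close>, so finitely many blocks suffice.
\<close>

definition schedule :: "nat \<Rightarrow> visit list" where
  "schedule nh =
     filter (\<lambda>v. visited_row v \<le> nh)
       (First 1 #
        concat (map (\<lambda>b. [First (3 * b + 4), First (3 * b + 3), First (3 * b + 2),
                          Second (3 * b + 3)]) [0..<nh]))"

fun visit_step ::
  "nat \<Rightarrow> nat \<Rightarrow> nat \<Rightarrow> tile set \<Rightarrow> visit \<Rightarrow> assignment \<Rightarrow> assignment \<Rightarrow> bool" where
  "visit_step nc nh nw T (First i) =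
     (if i mod 3 = 1 then row_step nc nh nw T (Dual 2) UNIV i
      else if i mod 3 = 0 then row_step nc nh nw T (Dual 1) {j. odd j} i
      else row_step nc nh nw T Standard UNIV i)"
| "visit_step nc nh nw T (Second i) = row_step nc nh nw T Standard UNIV i"

text \<open>A configuration consists of the remaining visits and the current assignment.\<close>

type_synonym config = "visit list \<times> assignment"

inductive alg_step :: "nat \<Rightarrow> nat \<Rightarrow> nat \<Rightarrow> tile set \<Rightarrow> config \<Rightarrow> config \<Rightarrow> bool"
  for nc nh nw T where
  "visit_step nc nh nw T v f f' \<Longrightarrow> alg_step nc nh nw T (v # vs, f) (vs, f')"

definition initial_config :: "nat \<Rightarrow> config" where
  "initial_config nh = (schedule nh, \<lambda>_. None)"

text \<open>
  Total correctness of the nondeterministic algorithm: there is no infinite execution, and an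
  execution that cannot be continued has carried out all visits (it is not stuck in a row step
  without solution) and outputs an assignment satisfying Q.
\<close>

definition terminates_with ::
  "nat \<Rightarrow> nat \<Rightarrow> nat \<Rightarrow> tile set \<Rightarrow> (assignment \<Rightarrow> bool) \<Rightarrow> bool" where
  "terminates_with nc nh nw T Q \<longleftrightarrow>
     Wellfounded.accp (alg_step nc nh nw T)\<inverse>\<inverse> (initial_config nh) \<and>
     (\<forall>vs f. (alg_step nc nh nw T)\<^sup>*\<^sup>* (initial_config nh) (vs, f) \<longrightarrow>
             (\<nexists>c. alg_step nc nh nw T (vs, f) c) \<longrightarrow> vs = [] \<and> Q f)"

end

theory Submission
  imports Defs
begin

text \<open>
  As every color lies on cycles of both transducer graphs, any single edge of a position can be
  matched by some tile, and a row between two void rows can be covered completely from left to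
  right. Hence the rows \<open>i \<equiv> 1 (mod 3)\<close> become full, the first visit of a row
  \<open>i \<equiv> 0 (mod 3)\<close> fills all odd positions, and afterwards all even positions of the row
  above are constrained from one side only and pairwise not adjacent, so they can be filled. At the
  second visit of row \<open>i\<close> its current contents are still feasible, so no tiles are lost. In this
  way each block of three rows receives at least two rows' worth of tiles; if the domain ends
  with a row \<open>i \<equiv> 2 (mod 3)\<close>, half of that row can be filled, which is more than needed. Since the penalties of a
  row add up to less than 1, an optimal row has at least as many tiles as any feasible row.
\<close>

section \<open>Cycles in transducer graphs\<close>

text \<open>Each tail on a walk is its start or has been entered by the preceding arc. On a closed
  walk the start is also the end, so every tail is a head as well.\<close>

lemma cas_heads:
  assumes "pre_digraph.cas G u p w" "p \<noteq> []"
  shows "w \<in> head G ` set p \<and> (\<forall>v \<in> tail G ` set p. v = u \<or> v \<in> head G ` set p)"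
  using assms
proof (induction p arbitrary: u)
  case Nil
  then show ?case by simp
next
  case (Cons e p)
  then show ?case
    by (cases "p = []") (auto simp: pre_digraph.cas.simps)
qed

text \<open>A vertex on a cycle is left and entered by arcs of that cycle. In this form the cycle
  hypotheses supply tiles with a prescribed color.\<close>

lemma all_on_cycles_arcs:
  assumes "all_on_cycles G" "v \<in> verts G"
  shows "\<exists>e \<in> arcs G. tail G e = v" "\<exists>e \<in> arcs G. head G e = v"
proof -
  obtain p where "pre_digraph.cycle G p" and v: "v \<in> tail G ` set p"
    using assms by (auto simp: all_on_cycles_def)
  then obtain u where "pre_digraph.awalk G u p u" "p \<noteq> []"
    by (auto simp: pre_digraph.cycle_def)
  then have sub: "set p \<subseteq> arcs G" and cas: "pre_digraph.cas G u p u"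
    by (auto simp: pre_digraph.awalk_def)
  show "\<exists>e \<in> arcs G. tail G e = v" using v sub by auto
  have "v \<in> head G ` set p" using cas_heads[OF cas \<open>p \<noteq> []\<close>] v by auto
  then show "\<exists>e \<in> arcs G. head G e = v" using sub by auto
qed


section \<open>Optimal rows\<close>

lemma finite_tiles_over: "finite (tiles_over nc)"
proof (rule finite_subset)
  show "tiles_over nc \<subseteq>
      (\<lambda>(a, b, c, d). Tile a b c d) ` ({1..nc} \<times> {1..nc} \<times> {1..nc} \<times> {1..nc})"
  proof
    fix t assume "t \<in> tiles_over nc"
    then show "t \<in> (\<lambda>(a, b, c, d). Tile a b c d) ` ({1..nc} \<times> {1..nc} \<times> {1..nc} \<times> {1..nc})"
      by (cases t) (force simp: tiles_over_def)
  qed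
qed simp

text \<open>A feasible row is a partial map from a subset of \<open>{1..nw}\<close> into the finite
  set \<open>T\<close>.\<close>

lemma finite_feasible_rows:
  assumes "finite T"
  shows "finite {r. feasible_row nw T f i J r}"
proof (rule finite_subset)
  show "{r. feasible_row nw T f i J r} \<subseteq> (\<Union>A \<in> Pow {1..nw}. {r. dom r = A \<and> ran r \<subseteq> T})"
    by (auto simp: feasible_row_def)
  show "finite (\<Union>A \<in> Pow {1..nw}. {r. dom r = A \<and> ran r \<subseteq> T})"
    by (rule finite_UN_I) (auto intro!: finite_set_of_finite_maps assms intro: finite_subset)
qed

text \<open>The void row is always feasible and there are finitely many candidates, so a minimum
  exists and no row step gets stuck.\<close>

lemma row_step_total:
  assumes "finite T"
  shows "\<exists>f'. row_step nc nh nw T k J i f f'"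
proof -
  let ?S = "{r. feasible_row nw T f i J r}"
  have "(\<lambda>_. None) \<in> ?S" by (simp add: feasible_row_def)
  then have "?S \<noteq> {}" by blast
  then obtain r where "is_arg_min (row_cost nc nh nw T k f i) (\<lambda>r. r \<in> ?S) r"
    using ex_is_arg_min_if_finite[OF finite_feasible_rows[OF assms]] by blast
  then show ?thesis by (auto simp: row_step_def)
qed

text \<open>Both kinds of step add at most two indicators, each weighted by half of
  \<open>1 / (real nw + 1)\<close>.\<close>

lemma penalty_bounds:
  "0 \<le> penalty nc nh nw T k f i j t" "penalty nc nh nw T k f i j t \<le> 1 / (real nw + 1)"
  by (cases k; auto simp: field_simps of_bool_def)+

text \<open>The cost is the number of voids plus a total penalty in [0, 1): at most
  \<open>nw\<close> tiles pay at most \<open>1 / (real nw + 1)\<close> each.\<close>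

lemma row_cost_bounds:
  assumes "dom r \<subseteq> {1..nw}"
  shows "real nw - real (card (dom r)) \<le> row_cost nc nh nw T k f i r"
    and "row_cost nc nh nw T k f i r < real nw - real (card (dom r)) + 1"
proof -
  let ?p = "\<lambda>j. penalty nc nh nw T k f i j (the (r j))"
  have dom: "{j \<in> {1..nw}. r j \<noteq> None} = dom r" using assms by auto
  have card_le: "card (dom r) \<le> nw" using card_mono[OF _ assms] by simp
  have "{j \<in> {1..nw}. r j = None} = {1..nw} - dom r" by auto
  then have "card {j \<in> {1..nw}. r j = None} = nw - card (dom r)"
    using assms by (simp add: card_Diff_subset finite_subset)
  then have cost: "row_cost nc nh nw T k f i r = real nw - real (card (dom r)) + sum ?p (dom r)"
    using card_le unfolding row_cost_def dom by simp
  have "0 \<le> sum ?p (dom r)" by (intro sum_nonneg penalty_bounds)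
  with cost show "real nw - real (card (dom r)) \<le> row_cost nc nh nw T k f i r" by simp
  have "sum ?p (dom r) \<le> real (card (dom r)) * (1 / (real nw + 1))"
    by (intro sum_bounded_above penalty_bounds)
  also have "\<dots> \<le> real nw * (1 / (real nw + 1))"
    using card_le by (intro mult_right_mono) auto
  also have "\<dots> < 1" by (simp add: field_simps)
  finally show "row_cost nc nh nw T k f i r < real nw - real (card (dom r)) + 1"
    using cost by simp
qed

text \<open>Void counts are integers, and the penalties stay below 1, so a cheaper row cannot have
  more voids.\<close>

lemma row_step_card_max:
  assumes "row_step nc nh nw T k J i f f'"
  obtains r where "feasible_row nw T f i J r" "f' = set_row i r f"
    "\<And>r'. feasible_row nw T f i J r' \<Longrightarrow> card (dom r') \<le> card (dom r)"
proof -
  obtain r where min: "is_arg_min (row_cost nc nh nw T k f i) (feasible_row nw T f i J) r"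
    and f': "f' = set_row i r f"
    using assms by (auto simp: row_step_def)
  then have feas: "feasible_row nw T f i J r" by (simp add: is_arg_min_def)
  have "card (dom r') \<le> card (dom r)" if feas': "feasible_row nw T f i J r'" for r'
  proof -
    have "row_cost nc nh nw T k f i r \<le> row_cost nc nh nw T k f i r'"
      using min feas' by (auto simp: is_arg_min_def not_less)
    moreover have "dom r \<subseteq> {1..nw}" "dom r' \<subseteq> {1..nw}"
      using feas feas' by (auto simp: feasible_row_def)
    ultimately have "real nw - real (card (dom r)) < real nw - real (card (dom r')) + 1"
      using row_cost_bounds[of r nw nc nh T k f i] row_cost_bounds[of r' nw nc nh T k f i]
      by linarith
    then show ?thesis by linarith
  qed
  with feas f' show thesis using that by blast
qed

section \<open>Covers under replacement of a single row\<close>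

lemma is_cover_SomeD:
  assumes "is_cover nh nw T f" "f (i, j) = Some t"
  shows "t \<in> T" "i \<in> {1..nh}" "j \<in> {1..nw}"
proof -
  have "t \<in> ran f" "(i, j) \<in> dom f" using assms(2) by (auto intro: ranI)
  then show "t \<in> T" "i \<in> {1..nh}" "j \<in> {1..nw}"
    using assms(1) unfolding is_cover_def domain_def by blast+
qed

lemma feasible_row_SomeD:
  assumes "feasible_row nw T f i J r" "r j = Some t"
  shows "t \<in> T" "j \<in> {1..nw}" "j \<in> J"
proof -
  have "t \<in> ran r" "j \<in> dom r" using assms(2) by (auto intro: ranI)
  then show "t \<in> T" "j \<in> {1..nw}" "j \<in> J"
    using assms(1) unfolding feasible_row_def by blast+
qed

lemma is_cover_set_row:
  assumes "is_cover nh nw T f" "feasible_row nw T f i J r" "i \<in> {1..nh}"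
  shows "is_cover nh nw T (set_row i r f)"
  unfolding is_cover_def
proof (intro conjI allI impI)
  have "(a, b) \<in> domain nh nw" if "set_row i r f (a, b) = Some t" for a b t
    using that is_cover_SomeD(2,3)[OF assms(1), of a b t] feasible_row_SomeD(2)[OF assms(2), of b t]
      assms(3)
    by (simp add: set_row_def domain_def split: if_splits)
  then show "dom (set_row i r f) \<subseteq> domain nh nw" by auto
  have "t \<in> T" if "set_row i r f (a, b) = Some t" for a b t
    using that is_cover_SomeD(1)[OF assms(1), of a b t] feasible_row_SomeD(1)[OF assms(2), of b t]
    by (simp add: set_row_def split: if_splits)
  then show "ran (set_row i r f) \<subseteq> T" by (auto simp: ran_def)
next
  fix a b s t
  assume "set_row i r f (a, b) = Some s" "set_row i r f (a, b + 1) = Some t"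
  then show "east s = west t"
    using assms by (auto simp: is_cover_def feasible_row_def set_row_def split: if_splits)
next
  fix a b s t
  assume st: "set_row i r f (a, b) = Some s" "set_row i r f (a + 1, b) = Some t"
  \<comment> \<open>A vertical pair meets the new row in its upper tile, in its lower tile, or not
    at all; the first two cases are the vertical conditions of \<open>feasible_row\<close>.\<close>
  consider "a = i" | "a + 1 = i" | "a \<noteq> i" "a + 1 \<noteq> i" by blast
  then show "south s = north t"
  proof cases
    case 1
    then show ?thesis using st assms(2) by (auto simp: set_row_def feasible_row_def)
  next
    case 2
    then have "f (i - 1, b) = Some s" "r b = Some t" using st by (auto simp: set_row_def)
    then show ?thesis using assms(2) by (auto simp: feasible_row_def)
  next
    case 3
    then show ?thesis using st assms(1) by (auto simp: set_row_def is_cover_def)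
  qed
qed

lemma is_cover_finite_dom: "is_cover nh nw T f \<Longrightarrow> finite (dom f)"
  by (rule finite_subset[of _ "domain nh nw"]) (auto simp: is_cover_def domain_def)

text \<open>Both sides count the tiles outside row \<open>i\<close> plus the old and the new row.
  The additive form avoids truncated subtraction.\<close>

lemma card_dom_set_row:
  assumes "finite (dom f)" "finite (dom r)"
  shows "card (dom (set_row i r f)) + card (dom (\<lambda>j. f (i, j))) = card (dom f) + card (dom r)"
proof -
  let ?rest = "{p \<in> dom f. fst p \<noteq> i}"
  have row: "finite (dom (\<lambda>j. f (i, j)))"
    by (rule finite_subset[OF _ finite_imageI[OF assms(1), of snd]]) force
  have "dom f = ?rest \<union> Pair i ` dom (\<lambda>j. f (i, j))" by force
  moreover have "card (?rest \<union> Pair i ` dom (\<lambda>j. f (i, j))) =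
      card ?rest + card (Pair i ` dom (\<lambda>j. f (i, j)))"
    using assms row by (intro card_Un_disjoint) auto
  ultimately have 1: "card (dom f) = card ?rest + card (dom (\<lambda>j. f (i, j)))"
    by (simp add: card_image inj_on_def)
  have "dom (set_row i r f) = ?rest \<union> Pair i ` dom r"
    by (force simp: set_row_def split: if_splits)
  moreover have "card (?rest \<union> Pair i ` dom r) = card ?rest + card (Pair i ` dom r)"
    using assms by (intro card_Un_disjoint) auto
  ultimately have "card (dom (set_row i r f)) = card ?rest + card (dom r)"
    by (simp add: card_image inj_on_def)
  with 1 show ?thesis by simp
qed

lemma row_step_is_cover:
  assumes "row_step nc nh nw T k J i f f'" "is_cover nh nw T f" "i \<in> {1..nh}"
  shows "is_cover nh nw T f'"
  using row_step_card_max[OF assms(1)] is_cover_set_row[OF assms(2) _ assms(3)] by metis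

lemma row_step_other_rows:
  "row_step nc nh nw T k J i f f' \<Longrightarrow> a \<noteq> i \<Longrightarrow> f' (a, j) = f (a, j)"
  by (auto simp: row_step_def set_row_def)

lemma row_step_excluded_columns:
  assumes "row_step nc nh nw T k J i f f'" "j \<notin> J"
  shows "f' (i, j) = None"
proof -
  obtain r where r: "feasible_row nw T f i J r" "f' = set_row i r f"
    using row_step_card_max[OF assms(1)] by metis
  then show ?thesis
    using feasible_row_SomeD(3)[OF r(1), of j] assms(2) by (cases "r j") (auto simp: set_row_def)
qed

text \<open>Any feasible row \<open>r0\<close> bounds the result from below, so counting tiles
  reduces to exhibiting good feasible rows.\<close>

lemma row_step_card_ge:
  assumes "row_step nc nh nw T k J i f f'" "is_cover nh nw T f" "feasible_row nw T f i J r0"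
  shows "card (dom f) + card (dom r0) \<le> card (dom f') + card (dom (\<lambda>j. f (i, j)))"
proof -
  obtain r where r: "feasible_row nw T f i J r" "f' = set_row i r f"
    "card (dom r0) \<le> card (dom r)"
    using row_step_card_max[OF assms(1)] assms(3) by metis
  have "finite (dom r)"
    by (rule finite_subset[of _ "{1..nw}"]) (use r in \<open>auto simp: feasible_row_def\<close>)
  then show ?thesis
    using card_dom_set_row[of f r i] is_cover_finite_dom[OF assms(2)] r by simp
qed


section \<open>Feasible rows\<close>

locale cyclic_tiles =
  fixes nc :: nat and T :: "tile set"
  assumes color_exists: "1 \<le> nc"
    and tiles_over: "T \<subseteq> tiles_over nc"
    and cycles_h: "all_on_cycles (transducer_h nc T)"
    and cycles_v: "all_on_cycles (transducer_v nc T)"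
begin

lemma finite_T: "finite T"
  using finite_subset[OF tiles_over finite_tiles_over] .

lemma ex_west: "c \<in> {1..nc} \<Longrightarrow> \<exists>t \<in> T. west t = c"
  and ex_north: "c \<in> {1..nc} \<Longrightarrow> \<exists>t \<in> T. north t = c"
  and ex_south: "c \<in> {1..nc} \<Longrightarrow> \<exists>t \<in> T. south t = c"
  using all_on_cycles_arcs(1)[OF cycles_h, of c] all_on_cycles_arcs[OF cycles_v, of c]
  by (simp_all add: transducer_h_def transducer_v_def)

text \<open>With void rows above and below, only east/west colors matter, and every east color is
  the west color of some tile.\<close>

lemma ex_full_row:
  assumes "\<And>j. f (i - 1, j) = None" "\<And>j. f (i + 1, j) = None"
  shows "\<exists>r. feasible_row nw T f i UNIV r \<and> dom r = {1..nw}"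
proof -
  \<comment> \<open>An infinite horizontal chain of tiles is chosen first and then cut down to the
    columns \<open>{1..nw}\<close>.\<close>
  have "\<exists>g. \<forall>n. g n \<in> T \<and> east (g n) = west (g (Suc n))"
  proof (rule dependent_nat_choice)
    show "\<exists>t. t \<in> T" using ex_west[of 1] color_exists by auto
    show "\<exists>u. u \<in> T \<and> east t = west u" if "t \<in> T" for t n
    proof -
      have "east t \<in> {1..nc}" using that tiles_over by (auto simp: tiles_over_def)
      then show ?thesis using ex_west by metis
    qed
  qed
  then obtain g where g: "\<And>n. g n \<in> T" "\<And>n. east (g n) = west (g (Suc n))" by blast
  let ?r = "\<lambda>j. if j \<in> {1..nw} then Some (g j) else None"
  have "feasible_row nw T f i UNIV ?r"
    unfolding feasible_row_def
  proof (intro conjI allI impI)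
    show "ran ?r \<subseteq> T" using g(1) by (auto simp: ran_def)
    show "east s = west t" if "?r j = Some s" "?r (j + 1) = Some t" for j s t
      using that g(2)[of j] by (simp split: if_splits)
  qed (use assms in \<open>auto split: if_splits\<close>)
  moreover have "dom ?r = {1..nw}" by (auto split: if_splits)
  ultimately show ?thesis by blast
qed

text \<open>Positions in \<open>P\<close> are never horizontally adjacent, and each has at most one
  vertical neighbor tile, so one edge color at most is prescribed and the tiles can be chosen
  independently.\<close>

lemma ex_isolated_row:
  assumes "is_cover nh nw T f" "P \<subseteq> {1..nw} \<inter> J" "\<And>j. j \<in> P \<Longrightarrow> j + 1 \<notin> P"
    and "\<And>j. j \<in> P \<Longrightarrow> f (i - 1, j) = None \<or> f (i + 1, j) = None"
  shows "\<exists>r. feasible_row nw T f i J r \<and> dom r = P"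
proof -
  let ?ok = "\<lambda>j t. t \<in> T \<and> (\<forall>s. f (i - 1, j) = Some s \<longrightarrow> south s = north t) \<and>
    (\<forall>s. f (i + 1, j) = Some s \<longrightarrow> south t = north s)"
  have colors: "north s \<in> {1..nc}" "south s \<in> {1..nc}" if "f p = Some s" for p s
  proof -
    have "s \<in> T" using is_cover_SomeD(1)[OF assms(1)] that by (cases p) blast
    then show "north s \<in> {1..nc}" "south s \<in> {1..nc}"
      using tiles_over by (auto simp: tiles_over_def)
  qed
  have "\<exists>t. ?ok j t" if "j \<in> P" for j
  proof (cases "f (i - 1, j)")
    case (Some s)
    then have "f (i + 1, j) = None" using assms(4)[OF that] by simp
    then show ?thesis using ex_north[OF colors(2)[OF Some]] Some by auto
  next
    case above: None
    show ?thesis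
    proof (cases "f (i + 1, j)")
      case (Some s)
      then show ?thesis using ex_south[OF colors(1)[OF Some]] above by auto
    next
      case None
      then show ?thesis using ex_west[of 1] color_exists above by auto
    qed
  qed
  then obtain g where g: "\<And>j. j \<in> P \<Longrightarrow> ?ok j (g j)" by metis
  let ?r = "\<lambda>j. if j \<in> P then Some (g j) else None"
  have dom: "dom ?r = P" by (auto split: if_splits)
  have "feasible_row nw T f i J ?r"
    unfolding feasible_row_def dom
  proof (intro conjI allI impI)
    show "P \<subseteq> {1..nw} \<inter> J" by fact
    show "ran ?r \<subseteq> T" using g by (auto simp: ran_def)
    show "east s = west t" if "?r j = Some s" "?r (j + 1) = Some t" for j s t
      using that assms(3)[of j] by (simp split: if_splits)
    show "south s = north t" if "f (i - 1, j) = Some s" "?r j = Some t" for j s t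
      using that g[of j] by (simp split: if_splits)
    show "south s = north t" if "?r j = Some s" "f (i + 1, j) = Some t" for j s t
      using that g[of j] by (auto split: if_splits)
  qed
  with dom show ?thesis by blast
qed


section \<open>Executions\<close>

text \<open>Complete runs of a list of visits, with the remaining visits left out of the state, so
  that the schedule can be split into blocks.\<close>

fun executes :: "nat \<Rightarrow> nat \<Rightarrow> visit list \<Rightarrow> assignment \<Rightarrow> assignment \<Rightarrow> bool" where
  "executes nh nw [] f f' \<longleftrightarrow> f' = f"
| "executes nh nw (v # vs) f f' \<longleftrightarrow>
     (\<exists>g. visit_step nc nh nw T v f g \<and> executes nh nw vs g f')"

lemma executes_append:
  "executes nh nw (us @ vs) f f' \<longleftrightarrow> (\<exists>g. executes nh nw us f g \<and> executes nh nw vs g f')"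
  by (induction us arbitrary: f) auto

lemma alg_steps_executes:
  assumes "(alg_step nc nh nw T)\<^sup>*\<^sup>* (vs, f) (ws, g)"
  shows "\<exists>us. vs = us @ ws \<and> executes nh nw us f g"
  using assms
proof (induction rule: converse_rtranclp_induct2)
  case refl
  then show ?case by simp
next
  case (step vs f vs' f')
  from step.hyps(1) obtain v where v: "vs = v # vs'" "visit_step nc nh nw T v f f'"
    by cases blast
  from step.IH obtain us where "vs' = us @ ws" "executes nh nw us f' g" by blast
  with v show ?case by (intro exI[of _ "v # us"]) auto
qed

lemma alg_step_progress: "vs \<noteq> [] \<Longrightarrow> \<exists>c. alg_step nc nh nw T (vs, f) c"
proof -
  assume "vs \<noteq> []"
  then obtain v ws where vs: "vs = v # ws" by (cases vs) auto
  obtain f' where "visit_step nc nh nw T v f f'"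
  proof (cases v)
    case (First i)
    then show thesis
      using that row_step_total[OF finite_T, of nc nh nw _ _ i f]
      by (cases "i mod 3 = 1"; cases "i mod 3 = 0") (simp, meson)+
  next
    case (Second i)
    then show thesis using row_step_total[OF finite_T] that by simp meson
  qed
  then show ?thesis unfolding vs by (blast intro: alg_step.intros)
qed

text \<open>Each step consumes one visit; the assignment is generalized because it changes along the
  way.\<close>

lemma alg_step_terminates: "Wellfounded.accp (alg_step nc nh nw T)\<inverse>\<inverse> (vs, f)"
proof (induction vs arbitrary: f)
  case Nil
  show ?case
  proof (rule accpI)
    fix c assume "(alg_step nc nh nw T)\<inverse>\<inverse> c ([], f)"
    then show "Wellfounded.accp (alg_step nc nh nw T)\<inverse>\<inverse> c"
      unfolding conversep_iff by cases
  qed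
next
  case (Cons v vs)
  show ?case
  proof (rule accpI)
    fix c assume "(alg_step nc nh nw T)\<inverse>\<inverse> c (v # vs, f)"
    then show "Wellfounded.accp (alg_step nc nh nw T)\<inverse>\<inverse> c"
      unfolding conversep_iff by cases (use Cons.IH in simp)
  qed
qed

text \<open>
  State after row 1 and the first \<open>b\<close> blocks of the schedule: the last row reached,
  \<open>3 * b + 1\<close>, is full and counts completely, the rows before it by two thirds.
\<close>

definition block_invariant :: "nat \<Rightarrow> nat \<Rightarrow> nat \<Rightarrow> assignment \<Rightarrow> bool" where
  "block_invariant nh nw b f \<longleftrightarrow>
     is_cover nh nw T f \<and> (\<forall>i j. 3 * b + 1 < i \<longrightarrow> f (i, j) = None) \<and>
     (if 3 * b + 1 \<le> nh then (6 * b + 3) * nw else 2 * nh * nw) \<le> 3 * card (dom f)"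

abbreviation block :: "nat \<Rightarrow> visit list" where
  "block b \<equiv> [First (3 * b + 4), First (3 * b + 3), First (3 * b + 2), Second (3 * b + 3)]"

section \<open>Counting tiles along the schedule\<close>

lemma full_row_step:
  assumes "row_step nc nh nw T k UNIV i f f'" "is_cover nh nw T f"
    and "\<And>j. f (i - 1, j) = None" "\<And>j. f (i, j) = None" "\<And>j. f (i + 1, j) = None"
  shows "card (dom f) + nw \<le> card (dom f')"
proof -
  obtain r where r: "feasible_row nw T f i UNIV r" "dom r = {1..nw}"
    using ex_full_row[of f i nw] assms by blast
  from row_step_card_ge[OF assms(1,2) r(1)] r(2) assms(4) show ?thesis by simp
qed

lemma isolated_row_step:
  assumes "row_step nc nh nw T k J i f f'" "is_cover nh nw T f"
    and "P \<subseteq> {1..nw} \<inter> J" "\<And>j. j \<in> P \<Longrightarrow> j + 1 \<notin> P"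
    and "\<And>j. j \<in> P \<Longrightarrow> f (i - 1, j) = None \<or> f (i + 1, j) = None"
    and "\<And>j. f (i, j) = None"
  shows "card (dom f) + card P \<le> card (dom f')"
proof -
  obtain r where r: "feasible_row nw T f i J r" "dom r = P"
    using ex_isolated_row[OF assms(2-5)] by blast
  from row_step_card_ge[OF assms(1,2) r(1)] r(2) assms(6) show ?thesis by simp
qed

lemma first_row_invariant:
  assumes "executes nh nw (filter (\<lambda>v. visited_row v \<le> nh) [First 1]) (\<lambda>_. None) f"
  shows "block_invariant nh nw 0 f"
proof (cases "1 \<le> nh")
  case True
  then have step: "row_step nc nh nw T (Dual 2) UNIV 1 (\<lambda>_. None) f" using assms by simp
  have cover: "is_cover nh nw T (\<lambda>_. None)" by (simp add: is_cover_def)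
  have "nw \<le> card (dom f)" using full_row_step[OF step cover] by simp
  moreover have "is_cover nh nw T f" using row_step_is_cover[OF step cover] True by simp
  ultimately show ?thesis
    using True row_step_other_rows[OF step] by (simp add: block_invariant_def)
\<comment> \<open>For \<open>nh = 0\<close> the visit is filtered out and the required count is
  0.\<close>
next
  case False
  then show ?thesis using assms by (auto simp: block_invariant_def is_cover_def)
qed

text \<open>In a cover the row already matches its neighbors. Hence revisiting a row without column
  restriction never loses tiles.\<close>

lemma feasible_current_row:
  assumes "is_cover nh nw T f" "1 \<le> i"
  shows "feasible_row nw T f i UNIV (\<lambda>j. f (i, j))"
  unfolding feasible_row_def
proof (intro conjI allI impI)
  show "dom (\<lambda>j. f (i, j)) \<subseteq> {1..nw} \<inter> UNIV" "ran (\<lambda>j. f (i, j)) \<subseteq> T"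
    using is_cover_SomeD[OF assms(1)] by (auto simp: ran_def)
  show "south s = north t" if "f (i - 1, j) = Some s" "f (i, j) = Some t" for j s t
    using assms that unfolding is_cover_def by (metis le_add_diff_inverse2)
qed (use assms in \<open>auto simp: is_cover_def\<close>)

text \<open>The odd columns of row \<open>3 * b + 3\<close> and the even columns of row
  \<open>3 * b + 2\<close> together yield \<open>nw\<close> new tiles, and the second visit keeps
  the count.\<close>

lemma three_row_block:
  assumes f1: "is_cover nh nw T f1" "3 * b + 3 \<le> nh"
    "\<And>j. f1 (3 * b + 2, j) = None" "\<And>j. f1 (3 * b + 3, j) = None"
    and steps: "executes nh nw [First (3 * b + 3), First (3 * b + 2), Second (3 * b + 3)] f1 f4"
  shows "is_cover nh nw T f4" "card (dom f1) + nw \<le> card (dom f4)"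
    "\<And>i j. 3 * b + 3 < i \<Longrightarrow> f4 (i, j) = f1 (i, j)"
proof -
  have "(3 * b + 3) mod 3 = 0" "(3 * b + 2) mod 3 = 2" by presburger+
  with steps obtain f2 f3 where
    s2: "row_step nc nh nw T (Dual 1) {j. odd j} (3 * b + 3) f1 f2" and
    s3: "row_step nc nh nw T Standard UNIV (3 * b + 2) f2 f3" and
    s4: "row_step nc nh nw T Standard UNIV (3 * b + 3) f3 f4"
    by auto
  let ?odd = "{j \<in> {1..nw}. odd j}" and ?even = "{j \<in> {1..nw}. even j}"
  have f2: "is_cover nh nw T f2" by (rule row_step_is_cover[OF s2]) (use f1 in auto)
  have f3: "is_cover nh nw T f3" by (rule row_step_is_cover[OF s3]) (use f1 f2 in auto)
  show "is_cover nh nw T f4" by (rule row_step_is_cover[OF s4]) (use f1 f3 in auto)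
  \<comment> \<open>Row \<open>3 * b + 2\<close> is still void, so these positions are constrained
    at most from below.\<close>
  have "card (dom f1) + card ?odd \<le> card (dom f2)"
    by (rule isolated_row_step[OF s2]) (use f1 in \<open>auto\<close>)
  moreover have "card (dom f2) + card ?even \<le> card (dom f3)"
  proof (rule isolated_row_step[OF s3 f2])
    \<comment> \<open>The even columns of row \<open>3 * b + 3\<close> were forced to be void, which
      leaves only the constraint from above.\<close>
    show "f2 (3 * b + 2 - 1, j) = None \<or> f2 (3 * b + 2 + 1, j) = None" if "j \<in> ?even" for j
      using row_step_excluded_columns[OF s2, of j] that by (simp add: numeral_3_eq_3)
    show "f2 (3 * b + 2, j) = None" for j
      using row_step_other_rows[OF s2, of "3 * b + 2"] f1 by simp
  qed (use f1 in auto)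
  moreover have "card (dom f3) \<le> card (dom f4)"
    using row_step_card_ge[OF s4 f3 feasible_current_row[OF f3]] f1 by simp
  moreover have "card ?odd + card ?even = card (?odd \<union> ?even)"
    by (rule card_Un_disjoint[symmetric]) auto
  moreover have "?odd \<union> ?even = {1..nw}" by auto
  ultimately show "card (dom f1) + nw \<le> card (dom f4)" by simp
  show "f4 (i, j) = f1 (i, j)" if "3 * b + 3 < i" for i j
    using that row_step_other_rows[OF s2] row_step_other_rows[OF s3] row_step_other_rows[OF s4]
    by simp
qed

text \<open>The cases distinguish how many of the rows \<open>3 * b + 2\<close>,
  \<open>3 * b + 3\<close> and \<open>3 * b + 4\<close> lie in the domain.\<close>

lemma block_preserves_invariant:
  assumes inv: "block_invariant nh nw b f"
    and steps: "executes nh nw (filter (\<lambda>v. visited_row v \<le> nh) (block b)) f f'"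
  shows "block_invariant nh nw (Suc b) f'"
proof -
  have cover: "is_cover nh nw T f" and void: "\<And>i j. 3 * b + 1 < i \<Longrightarrow> f (i, j) = None"
    and count: "(if 3 * b + 1 \<le> nh then (6 * b + 3) * nw else 2 * nh * nw) \<le> 3 * card (dom f)"
    using inv unfolding block_invariant_def by blast+
  consider "nh \<le> 3 * b + 1" | "nh = 3 * b + 2" | "nh = 3 * b + 3" | "3 * b + 4 \<le> nh"
    by linarith
  then show ?thesis
  proof cases
    case 1
    then have "f' = f" using steps by simp
    moreover have "2 * nh * nw \<le> 3 * card (dom f)"
    proof (cases "3 * b + 1 \<le> nh")
      case True
      \<comment> \<open>Here \<open>nh = 3 * b + 1\<close>, so \<open>2 * nh\<close> is
        \<open>6 * b + 2\<close>.\<close>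
      have "2 * nh * nw \<le> (6 * b + 3) * nw" using 1 by (intro mult_right_mono) auto
      also have "\<dots> \<le> 3 * card (dom f)" using True count by simp
      finally show ?thesis .
    qed (use count in simp)
    ultimately show ?thesis using 1 cover void by (simp add: block_invariant_def)
  next
    case 2
    have "(3 * b + 2) mod 3 = 2" by presburger
    with 2 steps have step: "row_step nc nh nw T Standard UNIV (3 * b + 2) f f'" by simp
    have cover': "is_cover nh nw T f'" by (rule row_step_is_cover[OF step cover]) (use 2 in simp)
    have count': "card (dom f) + card P \<le> card (dom f')"
      if "P \<subseteq> {1..nw}" "\<And>j. j \<in> P \<Longrightarrow> j + 1 \<notin> P" for P
    proof (rule isolated_row_step[OF step cover])
      show "P \<subseteq> {1..nw} \<inter> UNIV" using that(1) by simp
      show "\<And>j. j \<in> P \<Longrightarrow> j + 1 \<notin> P" by (rule that(2))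
    qed (simp_all add: void)
    let ?odd = "{j \<in> {1..nw}. odd j}" and ?even = "{j \<in> {1..nw}. even j}"
    have "card ?odd + card ?even = card (?odd \<union> ?even)"
      by (rule card_Un_disjoint[symmetric]) auto
    moreover have "?odd \<union> ?even = {1..nw}" by auto
    moreover have "card (dom f) + card ?odd \<le> card (dom f')" by (rule count') auto
    moreover have "card (dom f) + card ?even \<le> card (dom f')" by (rule count') auto
    \<comment> \<open>Adding the bounds for both parities gives half a row without rounding. The
      need is \<open>6 * b + 4\<close> times \<open>nw\<close>, below the available 6b +
      4.5.\<close>
    ultimately have "2 * card (dom f) + nw \<le> 2 * card (dom f')" by simp
    moreover have "(6 * b + 3) * nw \<le> 3 * card (dom f)" using count 2 by simp
    ultimately have "2 * nh * nw \<le> 3 * card (dom f')" using 2 by (simp add: algebra_simps)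
    moreover have "f' (i, j) = None" if "3 * b + 4 < i" for i j
      using row_step_other_rows[OF step] void that by simp
    ultimately show ?thesis using cover' 2 by (simp add: block_invariant_def)
  next
    case 3
    then have rest: "executes nh nw [First (3 * b + 3), First (3 * b + 2), Second (3 * b + 3)] f f'"
      using steps by simp
    have "3 * b + 3 \<le> nh" "f (3 * b + 2, j) = None" "f (3 * b + 3, j) = None" for j
      using 3 by (simp_all add: void)
    note block = three_row_block[OF cover this rest]
    have "is_cover nh nw T f'" "card (dom f) + nw \<le> card (dom f')" using block(1,2) by simp_all
    moreover have "f' (i, j) = None" if "3 * b + 4 < i" for i j
      using block(3)[of i j] void[of i j] that by simp
    \<comment> \<open>The \<open>nw\<close> new tiles raise the coefficient to
      \<open>6 * b + 6\<close>, which is exactly \<open>2 * nh\<close>.\<close>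
    moreover have "(6 * b + 3) * nw \<le> 3 * card (dom f)" using count 3 by simp
    ultimately show ?thesis using 3 by (simp add: block_invariant_def algebra_simps)
  next
    case 4
    have "(3 * b + 4) mod 3 = 1" by presburger
    with 4 steps obtain f1 where step: "row_step nc nh nw T (Dual 2) UNIV (3 * b + 4) f f1"
      and rest: "executes nh nw [First (3 * b + 3), First (3 * b + 2), Second (3 * b + 3)] f1 f'"
      by auto
    have cover1: "is_cover nh nw T f1" by (rule row_step_is_cover[OF step cover]) (use 4 in simp)
    have other: "f1 (i, j) = f (i, j)" if "i \<noteq> 3 * b + 4" for i j
      using row_step_other_rows[OF step that] .
    have "card (dom f) + nw \<le> card (dom f1)"
      by (rule full_row_step[OF step cover]) (simp_all add: void)
    moreover have "3 * b + 3 \<le> nh" "f1 (3 * b + 2, j) = None" "f1 (3 * b + 3, j) = None" for j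
      using 4 void other by simp_all
    note block = three_row_block[OF cover1 this rest]
    have "is_cover nh nw T f'" "card (dom f1) + nw \<le> card (dom f')" using block(1,2) by simp_all
    moreover have "f' (i, j) = None" if "3 * b + 4 < i" for i j
      using block(3)[of i j] other[of i j] void[of i j] that by simp
    \<comment> \<open>A full row and the three-row gain add \<open>2 * nw\<close> tiles, hence the
      coefficient \<open>6 * b + 9\<close>, as the invariant for \<open>Suc b\<close>
      demands.\<close>
    moreover have "(6 * b + 3) * nw \<le> 3 * card (dom f)" using count 4 by simp
    ultimately show ?thesis using 4 by (simp add: block_invariant_def algebra_simps)
  qed
qed

text \<open>The number \<open>n\<close> of blocks is separated from the height \<open>nh\<close> in
  the filter, so that the induction runs over prefixes of one schedule.\<close>

lemma blocks_invariant:
  assumes "executes nh nw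
    (filter (\<lambda>v. visited_row v \<le> nh) (First 1 # concat (map block [0..<n]))) (\<lambda>_. None) f"
  shows "block_invariant nh nw n f"
  using assms
proof (induction n arbitrary: f)
  case 0
  then show ?case by (intro first_row_invariant) simp
next
  case (Suc n)
  let ?within = "filter (\<lambda>v. visited_row v \<le> nh)"
  have "?within (First 1 # concat (map block [0..<Suc n])) =
      ?within (First 1 # concat (map block [0..<n])) @ ?within (block n)"
    unfolding filter_append[symmetric] by simp
  with Suc.prems have "executes nh nw
      (?within (First 1 # concat (map block [0..<n])) @ ?within (block n)) (\<lambda>_. None) f"
    by (simp only:)
  then obtain g where
    g: "executes nh nw (?within (First 1 # concat (map block [0..<n]))) (\<lambda>_. None) g"
    "executes nh nw (?within (block n)) g f"
    unfolding executes_append by (elim exE conjE)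
  show ?case by (rule block_preserves_invariant[OF Suc.IH[OF g(1)] g(2)])
qed

lemma executes_schedule:
  assumes "executes nh nw (schedule nh) (\<lambda>_. None) f"
  shows "is_cover nh nw T f" "2 * (nh * nw) \<le> 3 * card (dom f)"
proof -
  \<comment> \<open>After \<open>nh\<close> blocks \<open>3 * nh + 1\<close> exceeds
    \<open>nh\<close>, so the invariant yields the bound for the whole domain.\<close>
  have "block_invariant nh nw nh f"
    by (rule blocks_invariant) (use assms in \<open>simp only: schedule_def\<close>)
  then show "is_cover nh nw T f" "2 * (nh * nw) \<le> 3 * card (dom f)"
    by (auto simp: block_invariant_def split: if_splits)
qed

end

theorem lemma4p1:
  fixes nc nh nw :: nat and T :: "tile set"
  assumes "1 \<le> nc"
    and "T \<subseteq> tiles_over nc"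
    and "all_on_cycles (transducer_h nc T)"
    and "all_on_cycles (transducer_v nc T)"
  shows "terminates_with nc nh nw T
           (\<lambda>f. is_cover nh nw T f \<and>
                real (card (dom f)) \<ge> 2 / 3 * real (card (domain nh nw)))"
proof -
  interpret cyclic_tiles nc T using assms by unfold_locales
  show ?thesis
    unfolding terminates_with_def
  proof (intro conjI allI impI)
    show "Wellfounded.accp (alg_step nc nh nw T)\<inverse>\<inverse> (initial_config nh)"
      unfolding initial_config_def by (rule alg_step_terminates)
  next
    fix vs f
    assume reach: "(alg_step nc nh nw T)\<^sup>*\<^sup>* (initial_config nh) (vs, f)"
      and stuck: "\<nexists>c. alg_step nc nh nw T (vs, f) c"
    show vs: "vs = []" using stuck alg_step_progress by blast
    \<comment> \<open>No visits remain, so the executed prefix is the entire schedule.\<close>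
    have exec: "executes nh nw (schedule nh) (\<lambda>_. None) f"
      using alg_steps_executes[OF reach[unfolded initial_config_def]] vs by simp
    show "is_cover nh nw T f" using executes_schedule(1)[OF exec] .
    have "real (2 * (nh * nw)) \<le> real (3 * card (dom f))"
      using executes_schedule(2)[OF exec] of_nat_mono by blast
    then show "2 / 3 * real (card (domain nh nw)) \<le> real (card (dom f))"
      by (simp add: domain_def)
  qed
qed

end
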